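(* Let $\mathbb{K}\in\{\mathbb{R},\mathbb{C}\}$, let $(H,\langle\cdot,\cdot\rangle)$ be an inner product space over $\mathbb{K}$ with norm $\|\cdot\|$, let $A,a\in\mathbb{K}$ and $x,y\in H$. The conditions $$\operatorname{Re}\langle Ay-x,\,x-ay\rangle\ge 0 \qquad\text{and}\qquad \left\|x-\frac{a+A}{2}\,y\right\|\le \frac12|A-a|\,\|y\|$$ are equivalent, and if either of them holds, then $$0\le \|x\|^2\|y\|^2-|\langle x,y\rangle|^2\le \frac14|A-a|^2\|y\|^4 .$$ The constant $\frac14$ is sharp in the last inequality, in the sense that there is no constant $C<\frac14$ such that $\|x\|^2\|y\|^2-|\langle x,y\rangle|^2\le C|A-a|^2\|y\|^4$ for all inner product spaces $H$ over $\mathbb{K}$, all $x,y\in H$ and all $a,A\in\mathbb{K}$ satisfying $\operatorname{Re}\langle Ay-x,x-ay\rangle\ge 0$.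
   Context: The inner product is linear in the first variable and conjugate-linear in the second, and $\|x\|=\langle x,x\rangle^{1/2}$. *)

theory Defs
  imports "HOL-Analysis.Inner_Product" "HOL-Algebra.Module"
begin

text \<open>
  The scalar field is a set \<open>K\<close> of complex numbers, either \<open>\<real>\<close> or \<open>UNIV\<close>, so that conjugation,
  real part and modulus of scalars have one meaning in both cases (on \<open>\<real>\<close> conjugation is the
  identity). Vector spaces over \<open>K\<close> are modules over the ring below. They have explicit carrier
  sets, which allows quantification over inner product spaces inside a formula. The \<open>mult\<close> and
  \<open>one\<close> fields of a module record carry no meaning here.
\<close>

definition scalar_ring :: "complex set \<Rightarrow> complex ring" where
  "scalar_ring K = \<lparr>carrier = K, mult = (*), one = 1, zero = 0, add = (+)\<rparr>"

locale inner_product_space = Module.module "scalar_ring K" H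
  for K :: "complex set" and H :: "(complex, 'v) module" (structure) +
  fixes ip :: "'v \<Rightarrow> 'v \<Rightarrow> complex"
  assumes scalars: "K \<in> {\<real>, UNIV}"
    and ip_closed: "\<lbrakk>x \<in> carrier H; y \<in> carrier H\<rbrakk> \<Longrightarrow> ip x y \<in> K"
    and ip_add_left: "\<lbrakk>x \<in> carrier H; y \<in> carrier H; z \<in> carrier H\<rbrakk>
      \<Longrightarrow> ip (x \<oplus> y) z = ip x z + ip y z"
    and ip_smult_left: "\<lbrakk>c \<in> K; x \<in> carrier H; y \<in> carrier H\<rbrakk> \<Longrightarrow> ip (c \<odot> x) y = c * ip x y"
    and ip_commute: "\<lbrakk>x \<in> carrier H; y \<in> carrier H\<rbrakk> \<Longrightarrow> ip y x = cnj (ip x y)"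
    and ip_ge_zero: "x \<in> carrier H \<Longrightarrow> 0 \<le> Re (ip x x)"
    and ip_definite: "\<lbrakk>x \<in> carrier H; ip x x = 0\<rbrakk> \<Longrightarrow> x = \<zero>"
begin

lemma ip_add_right:
  assumes "x \<in> carrier H" "y \<in> carrier H" "z \<in> carrier H"
  shows "ip x (y \<oplus> z) = ip x y + ip x z"
  using assms ip_commute[of "y \<oplus> z" x] ip_commute[of y x] ip_commute[of z x]
  by (simp add: ip_add_left)

lemma ip_smult_right:
  assumes "c \<in> K" "x \<in> carrier H" "y \<in> carrier H"
  shows "ip x (c \<odot> y) = cnj c * ip x y"
proof -
  have "c \<odot> y \<in> carrier H"
    using assms smult_closed[of c y] by (simp add: scalar_ring_def)
  then show ?thesis
    using assms ip_commute[of "c \<odot> y" x] ip_commute[of y x] by (simp add: ip_smult_left)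
qed

lemma ip_self_real: "x \<in> carrier H \<Longrightarrow> ip x x = of_real (Re (ip x x))"
  using arg_cong[OF ip_commute[of x x], of Im] by (simp add: complex_eq_iff)

end

text \<open>The inner product of a vector with itself is real (\<open>ip_self_real\<close>), so the following is
  the square root of it.\<close>

definition ip_norm :: "('v \<Rightarrow> 'v \<Rightarrow> complex) \<Rightarrow> 'v \<Rightarrow> real" where
  "ip_norm ip x = sqrt (Re (ip x x))"

text \<open>Every type of class \<open>real_inner\<close> is an inner product space over \<open>\<real>\<close> with the same norm,
  and \<open>\<complex>\<close> with its usual inner product is one over \<open>\<complex>\<close>.\<close>

lemma cring_scalar_ring:
  assumes "K \<in> {\<real>, UNIV}"
  shows "cring (scalar_ring K)"
proof -
  have cl: "0 \<in> K" "1 \<in> K" "\<And>a. a \<in> K \<Longrightarrow> - a \<in> K"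
    "\<And>a b. \<lbrakk>a \<in> K; b \<in> K\<rbrakk> \<Longrightarrow> a + b \<in> K \<and> a * b \<in> K"
    using assms by auto
  have "abelian_group (scalar_ring K)"
  proof (rule abelian_groupI)
    fix x assume "x \<in> carrier (scalar_ring K)"
    then show "\<exists>y\<in>carrier (scalar_ring K). y \<oplus>\<^bsub>scalar_ring K\<^esub> x = \<zero>\<^bsub>scalar_ring K\<^esub>"
      using cl(3) by (auto simp: scalar_ring_def intro!: bexI[of _ "- x"])
  qed (use cl in \<open>auto simp: scalar_ring_def\<close>)
  moreover have "comm_monoid (scalar_ring K)"
    by (rule comm_monoidI) (use cl in \<open>auto simp: scalar_ring_def\<close>)
  ultimately show ?thesis
    by (rule cringI) (simp add: scalar_ring_def algebra_simps)
qed

lemma inner_product_space_real_inner: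
  defines "H \<equiv> \<lparr>carrier = UNIV, mult = undefined, one = undefined, zero = 0, add = (+),
    smult = (\<lambda>c x. Re c *\<^sub>R x)\<rparr> :: (complex, 'v::real_inner) module"
  shows "inner_product_space \<real> H (\<lambda>x y. of_real (inner x y))"
proof -
  have g: "abelian_group H"
  proof (rule abelian_groupI)
    fix x show "\<exists>y\<in>carrier H. y \<oplus>\<^bsub>H\<^esub> x = \<zero>\<^bsub>H\<^esub>"
      by (auto simp: H_def intro!: exI[of _ "- x"])
  qed (auto simp: H_def)
  have "Module.module (scalar_ring \<real>) H"
    by (rule moduleI[OF cring_scalar_ring g])
      (simp_all add: H_def scalar_ring_def complex_is_Real_iff scaleR_add_left scaleR_add_right)
  then show ?thesis
    by (rule inner_product_space.intro, unfold_locales)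
      (simp_all add: H_def inner_add_left inner_add_right inner_commute complex_is_Real_iff complex_eq_iff)
qed

lemma ip_norm_real_inner:
  "ip_norm (\<lambda>x y. of_real (inner x y)) (x :: 'v::real_inner) = norm x"
  by (simp add: ip_norm_def norm_eq_sqrt_inner)

lemma inner_product_space_complex:
  defines "H \<equiv> \<lparr>carrier = UNIV, mult = undefined, one = undefined, zero = 0, add = (+),
    smult = (*)\<rparr> :: (complex, complex) module"
  shows "inner_product_space UNIV H (\<lambda>x y. x * cnj y)"
proof -
  have g: "abelian_group H"
  proof (rule abelian_groupI)
    fix x show "\<exists>y\<in>carrier H. y \<oplus>\<^bsub>H\<^esub> x = \<zero>\<^bsub>H\<^esub>"
      by (auto simp: H_def intro!: exI[of _ "- x"])
  qed (auto simp: H_def)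
  have "Module.module (scalar_ring UNIV) H"
    by (rule moduleI[OF cring_scalar_ring g])
      (auto simp: H_def scalar_ring_def algebra_simps)
  then show ?thesis
    by (rule inner_product_space.intro, unfold_locales)
      (auto simp: H_def algebra_simps)
qed

end

theory Submission
  imports Defs
begin

text \<open>
  With \<open>c = (a + A) / 2\<close>, expanding both sides gives
  \<open>Re \<langle>Ay - x, x - ay\<rangle> = \<bar>A - a\<bar>\<^sup>2 \<parallel>y\<parallel>\<^sup>2 / 4 - \<parallel>x - cy\<parallel>\<^sup>2\<close>, hence the equivalence. The bounds follow from
  \<open>\<parallel>y\<parallel>\<^sup>2 \<parallel>x - cy\<parallel>\<^sup>2 = \<parallel>x\<parallel>\<^sup>2 \<parallel>y\<parallel>\<^sup>2 - \<bar>\<langle>x, y\<rangle>\<bar>\<^sup>2 + \<bar>\<langle>x, y\<rangle> - c \<parallel>y\<parallel>\<^sup>2\<bar>\<^sup>2\<close>, which holds for every scalar \<open>c\<close>.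
  Equality occurs for an orthonormal pair \<open>x, y\<close> with \<open>A = 1\<close> and \<open>a = -1\<close>.
\<close>

context inner_product_space
begin

lemma smult_mem [simp]: "\<lbrakk>c \<in> K; x \<in> carrier H\<rbrakk> \<Longrightarrow> c \<odot> x \<in> carrier H"
  using smult_closed[of c x] by (simp add: scalar_ring_def)

lemma ip_zero_left: "z \<in> carrier H \<Longrightarrow> ip \<zero> z = 0"
  using ip_add_left[of \<zero> \<zero> z] by simp

lemma ip_uminus_left:
  assumes "x \<in> carrier H" "z \<in> carrier H"
  shows "ip (\<ominus> x) z = - ip x z"
  using assms ip_add_left[of x "\<ominus> x" z] by (simp add: r_neg ip_zero_left eq_neg_iff_add_eq_0 add.commute)

lemma ip_minus_left:
  assumes "x \<in> carrier H" "y \<in> carrier H" "z \<in> carrier H"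
  shows "ip (x \<ominus> y) z = ip x z - ip y z"
  using assms by (simp add: a_minus_def ip_add_left ip_uminus_left)

lemma ip_minus_right:
  assumes "x \<in> carrier H" "y \<in> carrier H" "z \<in> carrier H"
  shows "ip z (x \<ominus> y) = ip z x - ip z y"
  using assms ip_commute[of "x \<ominus> y" z] ip_commute[of x z] ip_commute[of y z]
  by (simp add: ip_minus_left)

lemma ip_norm_sq: "x \<in> carrier H \<Longrightarrow> (ip_norm ip x)\<^sup>2 = Re (ip x x)"
  by (simp add: ip_norm_def ip_ge_zero)

lemma ip_norm_nonneg: "x \<in> carrier H \<Longrightarrow> 0 \<le> ip_norm ip x"
  by (simp add: ip_norm_def ip_ge_zero)

lemma ip_self: "x \<in> carrier H \<Longrightarrow> ip x x = of_real ((ip_norm ip x)\<^sup>2)"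
  using ip_self_real ip_norm_sq by simp

lemma ip_norm_sq_minus_smult:
  assumes "c \<in> K" "x \<in> carrier H" "y \<in> carrier H"
  shows "(ip_norm ip (x \<ominus> c \<odot> y))\<^sup>2 =
    (ip_norm ip x)\<^sup>2 - 2 * Re (c * cnj (ip x y)) + (cmod c)\<^sup>2 * (ip_norm ip y)\<^sup>2"
proof -
  have "(ip_norm ip (x \<ominus> c \<odot> y))\<^sup>2 = Re (ip (x \<ominus> c \<odot> y) (x \<ominus> c \<odot> y))"
    using assms by (simp add: ip_norm_sq)
  also have "ip (x \<ominus> c \<odot> y) (x \<ominus> c \<odot> y) =
      ip x x - cnj c * ip x y - c * cnj (ip x y) + c * cnj c * ip y y"
    using assms ip_commute[of x y]
    by (simp add: ip_minus_left ip_minus_right ip_smult_left ip_smult_right algebra_simps)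
  also have "Re \<dots> = (ip_norm ip x)\<^sup>2 - 2 * Re (c * cnj (ip x y)) + (cmod c)\<^sup>2 * (ip_norm ip y)\<^sup>2"
    using assms unfolding complex_mult_cnj cmod_power2
    by (simp add: ip_self[of x] ip_self[of y])
  finally show ?thesis .
qed

text \<open>Put \<open>c = (a + A) / 2\<close>, \<open>w = x - c y\<close> and
  \<open>d = ((A - a) / 2) y\<close>. Then \<open>A y - x = d - w\<close> and
  \<open>x - a y = d + w\<close>, and in <d - w, d + w> the cross terms <d, w> - <w, d> are purely
  imaginary, so the real part is |d|^2 - |w|^2. The proof reaches the same identity by expanding
  both sides in <x, x>, <x, y> and <y, y>.\<close>

lemma Re_ip_eq_norm_diff:
  assumes "A \<in> K" "a \<in> K" "(a + A) / 2 \<in> K" "x \<in> carrier H" "y \<in> carrier H"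
  shows "Re (ip (A \<odot> y \<ominus> x) (x \<ominus> a \<odot> y)) =
    (1 / 2 * cmod (A - a) * ip_norm ip y)\<^sup>2 - (ip_norm ip (x \<ominus> ((a + A) / 2) \<odot> y))\<^sup>2"
proof -
  have "ip (A \<odot> y \<ominus> x) (x \<ominus> a \<odot> y) =
      A * cnj (ip x y) - A * cnj a * ip y y - ip x x + cnj a * ip x y"
    using assms ip_commute[of x y]
    by (simp add: ip_minus_left ip_minus_right ip_smult_left ip_smult_right algebra_simps)
  then have "Re (ip (A \<odot> y \<ominus> x) (x \<ominus> a \<odot> y)) = Re (A * cnj (ip x y))
      - Re (A * cnj a) * (ip_norm ip y)\<^sup>2 - (ip_norm ip x)\<^sup>2 + Re (cnj a * ip x y)"
    using assms(4,5) by (simp add: ip_self)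
  then show ?thesis
    unfolding ip_norm_sq_minus_smult[OF assms(3-5)] power_mult_distrib cmod_power2
    by (simp add: power2_eq_square field_simps)
qed

text \<open>This completes the square in \<open>c\<close>. Multiplying by |y|^2 instead of dividing
  by it keeps the identity valid for y = 0. It serves both bounds: a \<open>c\<close> that makes the
  last square vanish gives Cauchy-Schwarz, and the midpoint \<open>c = (a + A) / 2\<close> gives the
  upper bound.\<close>

lemma norm_sq_mult_norm_sq_minus_smult:
  assumes "c \<in> K" "x \<in> carrier H" "y \<in> carrier H"
  shows "(ip_norm ip y)\<^sup>2 * (ip_norm ip (x \<ominus> c \<odot> y))\<^sup>2 =
    (ip_norm ip x)\<^sup>2 * (ip_norm ip y)\<^sup>2 - (cmod (ip x y))\<^sup>2
      + (cmod (ip x y - c * of_real ((ip_norm ip y)\<^sup>2)))\<^sup>2"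
  unfolding ip_norm_sq_minus_smult[OF assms] cmod_power2
  by (simp add: power2_eq_square algebra_simps)

lemma Cauchy_Schwarz_ip:
  assumes "x \<in> carrier H" "y \<in> carrier H"
  shows "(cmod (ip x y))\<^sup>2 \<le> (ip_norm ip x)\<^sup>2 * (ip_norm ip y)\<^sup>2"
proof (cases "ip_norm ip y = 0")
  case True
  then have "y = \<zero>"
    using assms ip_self[of y] by (intro ip_definite) auto
  then have "ip x y = 0"
    using assms ip_commute[of y x] by (simp add: ip_zero_left)
  then show ?thesis by simp
next
  case False
  \<comment> \<open>The coefficient of the orthogonal projection of \<open>x\<close> onto the line
    through \<open>y\<close>; for it the last square in the identity is zero.\<close>
  let ?c = "ip x y / of_real ((ip_norm ip y)\<^sup>2)"
  have "?c \<in> K"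
    using scalars ip_closed[OF assms] by auto
  from norm_sq_mult_norm_sq_minus_smult[OF this assms]
  have "(ip_norm ip x)\<^sup>2 * (ip_norm ip y)\<^sup>2 - (cmod (ip x y))\<^sup>2 =
      (ip_norm ip y)\<^sup>2 * (ip_norm ip (x \<ominus> ?c \<odot> y))\<^sup>2"
    using False by simp
  also have "\<dots> \<ge> 0" by simp
  finally show ?thesis by simp
qed

end

text \<open>The two-dimensional space K^2, one model for both scalar fields. Vectors are functions
  on \<open>nat\<close> because the sharpness claim ranges over spaces whose vectors have that type;
  the entries from index 2 on are forced to be 0 so that \<open>plane_ip\<close>, which sees only
  the entries 0 and 1, is definite.\<close>

definition plane :: "complex set \<Rightarrow> (complex, nat \<Rightarrow> complex) module" where
  "plane K = \<lparr>carrier = {f. f 0 \<in> K \<and> f 1 \<in> K \<and> (\<forall>n\<ge>2. f n = 0)}, mult = undefined,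
    one = undefined, zero = (\<lambda>_. 0), add = (\<lambda>f g n. f n + g n), smult = (\<lambda>c f n. c * f n)\<rparr>"

definition plane_ip :: "(nat \<Rightarrow> complex) \<Rightarrow> (nat \<Rightarrow> complex) \<Rightarrow> complex" where
  "plane_ip f g = f 0 * cnj (g 0) + f 1 * cnj (g 1)"

lemma inner_product_space_plane:
  assumes K: "K \<in> {\<real>, UNIV}"
  shows "inner_product_space K (plane K) plane_ip"
proof -
  have g: "abelian_group (plane K)"
  proof (rule abelian_groupI)
    fix f assume "f \<in> carrier (plane K)"
    then show "\<exists>h\<in>carrier (plane K). h \<oplus>\<^bsub>plane K\<^esub> f = \<zero>\<^bsub>plane K\<^esub>"
      using K by (intro bexI[of _ "\<lambda>n. - f n"]) (auto simp: plane_def)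
  qed (use K in \<open>auto simp: plane_def algebra_simps\<close>)
  have "Module.module (scalar_ring K) (plane K)"
    by (rule moduleI[OF cring_scalar_ring[OF K] g])
      (use K in \<open>auto simp: plane_def scalar_ring_def algebra_simps\<close>)
  then show ?thesis
  proof (rule inner_product_space.intro, unfold_locales)
    fix f assume f: "f \<in> carrier (plane K)" and "plane_ip f f = 0"
    \<comment> \<open>Rewriting each z * cnj z as a real square turns the complex equation into a
      vanishing sum of nonnegative reals.\<close>
    then have "(cmod (f 0))\<^sup>2 + (cmod (f 1))\<^sup>2 = 0"
      unfolding plane_ip_def complex_norm_square[symmetric] of_real_add[symmetric]
      by (simp only: of_real_eq_0_iff)
    then have "f 0 = 0" "f 1 = 0"
      by (simp_all add: sum_power2_eq_zero_iff)
    moreover have "f n = 0" if "n \<ge> 2" for n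
      using f that by (simp add: plane_def)
    ultimately have "f n = 0" for n
      by (metis One_nat_def less_2_cases not_le)
    then show "f = \<zero>\<^bsub>plane K\<^esub>"
      by (auto simp: plane_def)
  qed (use K in \<open>auto simp: plane_def plane_ip_def complex_is_Real_iff algebra_simps\<close>)
qed

text \<open>In the plane, the orthonormal pair \<open>?u\<close>, \<open>?v\<close> with B = 1 and b
  = -1 makes the left side of \<open>bound\<close> equal to 1 and the right side equal to C * 2^2,
  hence 1 \<le> 4 C.\<close>

lemma sharp_constant:
  fixes C :: real
  assumes K: "K \<in> {\<real>, UNIV}"
    and bound: "\<And>(G :: (complex, nat \<Rightarrow> complex) module) jp u v b B.
      \<lbrakk>inner_product_space K G jp; u \<in> carrier G; v \<in> carrier G; b \<in> K; B \<in> K;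
        0 \<le> Re (jp (B \<odot>\<^bsub>G\<^esub> v \<ominus>\<^bsub>G\<^esub> u) (u \<ominus>\<^bsub>G\<^esub> b \<odot>\<^bsub>G\<^esub> v))\<rbrakk> \<Longrightarrow>
      (ip_norm jp u)\<^sup>2 * (ip_norm jp v)\<^sup>2 - (cmod (jp u v))\<^sup>2
        \<le> C * (cmod (B - b))\<^sup>2 * ip_norm jp v ^ 4"
  shows "1 / 4 \<le> C"
proof -
  interpret P: inner_product_space K "plane K" plane_ip
    using K by (rule inner_product_space_plane)
  let ?u = "(\<lambda>n. if n = 1 then 1 else 0) :: nat \<Rightarrow> complex"
  let ?v = "(\<lambda>n. if n = 0 then 1 else 0) :: nat \<Rightarrow> complex"
  have mem: "?u \<in> carrier (plane K)" "?v \<in> carrier (plane K)"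
    using K by (auto simp: plane_def)
  have one: "1 \<in> K" "- 1 \<in> K" and mid: "(- 1 + 1) / 2 \<in> K"
    using K by auto
  have ips: "plane_ip ?u ?v = 0" "ip_norm plane_ip ?u = 1" "ip_norm plane_ip ?v = 1"
    by (simp_all add: plane_ip_def ip_norm_def)
  \<comment> \<open>The midpoint of -1 and 1 is 0, so the value is |v|^2 - |u|^2 = 0: the pair
    satisfies the condition with equality.\<close>
  have "Re (plane_ip (1 \<odot>\<^bsub>plane K\<^esub> ?v \<ominus>\<^bsub>plane K\<^esub> ?u) (?u \<ominus>\<^bsub>plane K\<^esub> (- 1) \<odot>\<^bsub>plane K\<^esub> ?v)) = 0"
    unfolding P.Re_ip_eq_norm_diff[OF one mid mem] P.ip_norm_sq_minus_smult[OF mid mem] ips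
    by simp
  then show ?thesis
    using bound[OF P.inner_product_space_axioms mem one(2,1)] ips by simp
qed

theorem theorem1:
  fixes K :: "complex set" and H :: "(complex, 'v) module" (structure)
    and ip :: "'v \<Rightarrow> 'v \<Rightarrow> complex" and A a :: complex and x y :: 'v
  assumes "K \<in> {\<real>, UNIV}"
    and "inner_product_space K H ip"
    and "A \<in> K" and "a \<in> K" and "x \<in> carrier H" and "y \<in> carrier H"
  shows
    "(0 \<le> Re (ip (A \<odot> y \<ominus> x) (x \<ominus> a \<odot> y)) \<longleftrightarrow>
       ip_norm ip (x \<ominus> ((a + A) / 2) \<odot> y) \<le> 1 / 2 * cmod (A - a) * ip_norm ip y)
     \<and>
     (0 \<le> Re (ip (A \<odot> y \<ominus> x) (x \<ominus> a \<odot> y)) \<or>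
      ip_norm ip (x \<ominus> ((a + A) / 2) \<odot> y) \<le> 1 / 2 * cmod (A - a) * ip_norm ip y \<longrightarrow>
       0 \<le> (ip_norm ip x)\<^sup>2 * (ip_norm ip y)\<^sup>2 - (cmod (ip x y))\<^sup>2 \<and>
       (ip_norm ip x)\<^sup>2 * (ip_norm ip y)\<^sup>2 - (cmod (ip x y))\<^sup>2
         \<le> 1 / 4 * (cmod (A - a))\<^sup>2 * ip_norm ip y ^ 4)
     \<and>
     \<not> (\<exists>C::real. C < 1 / 4 \<and>
         (\<forall>(G :: (complex, nat \<Rightarrow> complex) module) jp.
            inner_product_space K G jp \<longrightarrow>
            (\<forall>u\<in>carrier G. \<forall>v\<in>carrier G. \<forall>b\<in>K. \<forall>B\<in>K.
               0 \<le> Re (jp (B \<odot>\<^bsub>G\<^esub> v \<ominus>\<^bsub>G\<^esub> u) (u \<ominus>\<^bsub>G\<^esub> b \<odot>\<^bsub>G\<^esub> v)) \<longrightarrow>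
               (ip_norm jp u)\<^sup>2 * (ip_norm jp v)\<^sup>2 - (cmod (jp u v))\<^sup>2
                 \<le> C * (cmod (B - b))\<^sup>2 * ip_norm jp v ^ 4)))"
proof (intro conjI)
  interpret inner_product_space K H ip by fact
  let ?c = "(a + A) / 2"
  let ?r = "1 / 2 * cmod (A - a) * ip_norm ip y"
  have c: "?c \<in> K"
    using assms(1,3,4) by auto
  have "Re (ip (A \<odot> y \<ominus> x) (x \<ominus> a \<odot> y)) = ?r\<^sup>2 - (ip_norm ip (x \<ominus> ?c \<odot> y))\<^sup>2"
    using assms(3,4) c assms(5,6) by (rule Re_ip_eq_norm_diff)
  moreover have "(ip_norm ip (x \<ominus> ?c \<odot> y))\<^sup>2 \<le> ?r\<^sup>2 \<longleftrightarrow> ip_norm ip (x \<ominus> ?c \<odot> y) \<le> ?r"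
    using assms(5,6) c by (intro power_mono_iff) (simp_all add: ip_norm_nonneg)
  ultimately show equiv: "0 \<le> Re (ip (A \<odot> y \<ominus> x) (x \<ominus> a \<odot> y)) \<longleftrightarrow>
      ip_norm ip (x \<ominus> ?c \<odot> y) \<le> ?r"
    by simp
  show "0 \<le> Re (ip (A \<odot> y \<ominus> x) (x \<ominus> a \<odot> y)) \<or> ip_norm ip (x \<ominus> ?c \<odot> y) \<le> ?r \<longrightarrow>
       0 \<le> (ip_norm ip x)\<^sup>2 * (ip_norm ip y)\<^sup>2 - (cmod (ip x y))\<^sup>2 \<and>
       (ip_norm ip x)\<^sup>2 * (ip_norm ip y)\<^sup>2 - (cmod (ip x y))\<^sup>2
         \<le> 1 / 4 * (cmod (A - a))\<^sup>2 * ip_norm ip y ^ 4"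
  proof (intro impI conjI)
    show "0 \<le> (ip_norm ip x)\<^sup>2 * (ip_norm ip y)\<^sup>2 - (cmod (ip x y))\<^sup>2"
      using Cauchy_Schwarz_ip[OF assms(5,6)] by simp
    assume "0 \<le> Re (ip (A \<odot> y \<ominus> x) (x \<ominus> a \<odot> y)) \<or> ip_norm ip (x \<ominus> ?c \<odot> y) \<le> ?r"
    with equiv have "ip_norm ip (x \<ominus> ?c \<odot> y) \<le> ?r"
      by blast
    then have "(ip_norm ip (x \<ominus> ?c \<odot> y))\<^sup>2 \<le> ?r\<^sup>2"
      using assms(5,6) c by (intro power_mono) (simp_all add: ip_norm_nonneg)
    then have "(ip_norm ip y)\<^sup>2 * (ip_norm ip (x \<ominus> ?c \<odot> y))\<^sup>2 \<le> (ip_norm ip y)\<^sup>2 * ?r\<^sup>2"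
      by (rule mult_left_mono) simp
    \<comment> \<open>The two sides differ by the square |<x, y> - c |y|^2|^2 from the completed
      square, which is nonnegative and is dropped here.\<close>
    moreover have "(ip_norm ip x)\<^sup>2 * (ip_norm ip y)\<^sup>2 - (cmod (ip x y))\<^sup>2
        \<le> (ip_norm ip y)\<^sup>2 * (ip_norm ip (x \<ominus> ?c \<odot> y))\<^sup>2"
      unfolding norm_sq_mult_norm_sq_minus_smult[OF c assms(5,6)] by simp
    moreover have "(ip_norm ip y)\<^sup>2 * ?r\<^sup>2 = 1 / 4 * (cmod (A - a))\<^sup>2 * ip_norm ip y ^ 4"
      by (simp add: power2_eq_square power4_eq_xxxx)
    ultimately show "(ip_norm ip x)\<^sup>2 * (ip_norm ip y)\<^sup>2 - (cmod (ip x y))\<^sup>2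
        \<le> 1 / 4 * (cmod (A - a))\<^sup>2 * ip_norm ip y ^ 4"
      by linarith
  qed
qed (use sharp_constant[OF assms(1)] in \<open>meson not_le\<close>)

end
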